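(* The category of finite-dimensional unital $C^*$-algebras and completely positive unital maps is S-positive. In fact, the category of unital $C^*$-algebras and Schwarz-positive unital (SPU) maps is S-positive. Explicitly: whenever $G:\mathcal{C}\to\mathcal{B}$ and $F:\mathcal{B}\to\mathcal{A}$ are SPU maps between unital $C^*$-algebras (in particular, whenever they are completely positive unital maps between finite-dimensional ones) such that the composite $F\circ G$ is a $*$-homomorphism, one has $$F\big(G(C)B\big)=F\big(G(C)\big)F(B)\qquad\text{for all } C\in\mathcal{C},\ B\in\mathcal{B}.$$
   Context: All $C^*$-algebras are unital. A linear map $F:\mathcal{B}\to\mathcal{A}$ of $C^*$-algebras is Schwarz-positive unital (SPU) if $F(1_{\mathcal{B}})=1_{\mathcal{A}}$ and $F(B^*B)\ge F(B)^*F(B)$ for all $B\in\mathcal{B}$; it is completely positive unital (CPU) if it is unital and $\mathrm{id}_{\mathcal{M}_n(\mathbb{C})}\otimes F$ is positive for every $n\in\mathbb{N}$. S-positivity: abstractly, in a category equipped with copy morphisms $\Delta_X:X\to X\otimes X$, a subcategory is S-positive if for every composable pair $X\xrightarrow{f}Y\xrightarrow{g}Z$ in it with $g\circ f$ deterministic (i.e. compatible with copying and with the involutions), $(g\otimes\mathrm{id}_Y)\circ\Delta_Y\circ f=((g\circ f)\otimes f)\circ\Delta_X$. For $C^*$-algebras one works in the opposite category (morphisms $X\to Y$ are linear maps $\mathcal{B}\to\mathcal{A}$ going backwards), the copy map is the multiplication map $A\otimes A'\mapsto AA'$, and the deterministic morphisms are the unital $*$-homomorphisms; the S-positivity condition is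 then exactly the explicit condition written in the claim. *)

theory Defs
  imports Complex_Main "Jordan_Normal_Form.Matrix"
begin

(* Unital C*-algebras.  The class monoid_mult is used instead of ring_1 or
   real_normed_algebra_1 because the latter impose 0 \<noteq> 1 and so exclude the zero
   algebra.  The scalar multiplication scaleR of banach is the restriction of
   scaleC to the reals. *)
class unital_cstar_algebra = banach + real_normed_algebra + monoid_mult +
  fixes scaleC :: "complex \<Rightarrow> 'a \<Rightarrow> 'a"
    and star :: "'a \<Rightarrow> 'a"
  assumes scaleC_add_right: "scaleC c (x + y) = scaleC c x + scaleC c y"
    and scaleC_add_left: "scaleC (c + d) x = scaleC c x + scaleC d x"
    and scaleC_scaleC: "scaleC c (scaleC d x) = scaleC (c * d) x"
    and scaleC_of_real: "scaleC (complex_of_real r) x = scaleR r x"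
    and scaleC_mult_left: "scaleC c x * y = scaleC c (x * y)"
    and scaleC_mult_right: "x * scaleC c y = scaleC c (x * y)"
    and norm_scaleC: "norm (scaleC c x) = cmod c * norm x"
    and star_star: "star (star x) = x"
    and star_add: "star (x + y) = star x + star y"
    and star_scaleC: "star (scaleC c x) = scaleC (cnj c) (star x)"
    and star_mult: "star (x * y) = star y * star x"
    and cstar_identity: "norm (star x * x) = (norm x)\<^sup>2"

lemma vector_space_scaleC:
  "vector_space (scaleC :: complex \<Rightarrow> 'a::unital_cstar_algebra \<Rightarrow> 'a)"
proof
  show "scaleC 1 x = x" for x :: 'a
    using scaleC_of_real[of 1 x] by simp
qed (rule scaleC_add_right scaleC_add_left scaleC_scaleC)+

abbreviation clinear :: "('b::unital_cstar_algebra \<Rightarrow> 'a::unital_cstar_algebra) \<Rightarrow> bool"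
  where "clinear \<equiv> Vector_Spaces.linear scaleC scaleC"

definition fin_dim_algebra :: "'a::unital_cstar_algebra itself \<Rightarrow> bool"
  where "fin_dim_algebra _ \<longleftrightarrow>
    (\<exists>S :: 'a set. finite S \<and> module.span scaleC S = UNIV)"

definition star_homomorphism ::
    "('b::unital_cstar_algebra \<Rightarrow> 'a::unital_cstar_algebra) \<Rightarrow> bool"
  where "star_homomorphism F \<longleftrightarrow> clinear F \<and>
    (\<forall>x y. F (x * y) = F x * F y) \<and> (\<forall>x. F (star x) = star (F x))"

definition cstar_positive :: "'a::unital_cstar_algebra \<Rightarrow> bool"
  where "cstar_positive a \<longleftrightarrow> (\<exists>x. a = star x * x)"

definition cstar_le :: "'a::unital_cstar_algebra \<Rightarrow> 'a \<Rightarrow> bool"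
  where "cstar_le a b \<longleftrightarrow> cstar_positive (b - a)"

definition SPU :: "('b::unital_cstar_algebra \<Rightarrow> 'a::unital_cstar_algebra) \<Rightarrow> bool"
  where "SPU F \<longleftrightarrow> clinear F \<and> F 1 = 1 \<and>
    (\<forall>B. cstar_le (star (F B) * F B) (F (star B * B)))"

(* The C*-algebra M_n(\<complex>) \<otimes> A is the *-algebra of n \<times> n matrices over A, with involution
   X \<mapsto> (star (X_ji))_ij; under this identification id \<otimes> F applies F to every entry. *)
definition mat_star :: "'a::unital_cstar_algebra mat \<Rightarrow> 'a mat"
  where "mat_star X = transpose_mat (map_mat star X)"

definition mat_positive :: "nat \<Rightarrow> 'a::unital_cstar_algebra mat \<Rightarrow> bool"
  where "mat_positive n M \<longleftrightarrow> (\<exists>X \<in> carrier_mat n n. M = mat_star X * X)"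

definition CPU :: "('b::unital_cstar_algebra \<Rightarrow> 'a::unital_cstar_algebra) \<Rightarrow> bool"
  where "CPU F \<longleftrightarrow> clinear F \<and> F 1 = 1 \<and>
    (\<forall>n. \<forall>M. mat_positive n M \<longrightarrow> mat_positive n (map_mat F M))"

end

theory Submission
  imports Defs
begin

text \<open>Positivity makes a Schwarz-positive map \<open>F\<close> star-preserving, and
  \<open>F (G (c\<^sup>*c)) \<ge> F (G(c)\<^sup>* G(c)) \<ge> F(G(c))\<^sup>* F(G(c))\<close>, where the outer terms agree because \<open>F \<circ> G\<close> is a
  homomorphism. So \<open>b = G(c)\<close> has vanishing defect \<open>D(b,b) = F(b\<^sup>*b) - F(b)\<^sup>*F(b)\<close>, and expanding
  \<open>D(x + tb, x + tb) \<ge> 0\<close> for all real \<open>t\<close> forces \<open>D(b,x) = 0\<close>. For completely positive maps, the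
  Schwarz inequality comes from the positive matrix \<open>X\<^sup>*X\<close> with first row \<open>(1, b)\<close> and second row 0.

  These arguments need the elements \<open>x\<^sup>*x\<close> to form a convex cone without lines. This is the
  Kelley-Vaught theorem, obtained here without spectral theory: self-adjoint \<open>h\<close> with
  \<open>\<parallel>t - h\<parallel> \<le> t\<close> for some \<open>t\<close> visibly form a cone, and square roots show that these are exactly
  the squares of self-adjoint elements.\<close>

section \<open>Square roots by iteration\<close>

text \<open>A limit \<open>w\<close> satisfies \<open>w = (c + ww) / 2\<close>, that is, \<open>(1 - w)\<^sup>2 = 1 - c\<close>. The scalar
  iteration at \<open>c = 1\<close> dominates all those with \<open>\<parallel>c\<parallel> \<le> 1\<close>, which covers the boundary case
  where the map is not a contraction.\<close>

primrec sqrt_iter :: "'a::real_normed_algebra \<Rightarrow> nat \<Rightarrow> 'a" where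
  "sqrt_iter c 0 = 0"
| "sqrt_iter c (Suc n) = (1/2) *\<^sub>R (c + sqrt_iter c n * sqrt_iter c n)"

lemma sqrt_iter_commute:
  assumes "c * z = z * c"
  shows "sqrt_iter c n * z = z * sqrt_iter c n"
proof (induction n)
  case (Suc n)
  have "sqrt_iter c n * sqrt_iter c n * z = z * (sqrt_iter c n * sqrt_iter c n)"
    by (metis Suc mult.assoc)
  with assms show ?case by (simp add: distrib_left distrib_right)
qed simp

text \<open>Consecutive iterates commute, so the difference of their squares factors. This reduces
  each increment to the previous one.\<close>

lemma sqrt_iter_diff:
  "sqrt_iter c (Suc (Suc n)) - sqrt_iter c (Suc n) =
    (1/2) *\<^sub>R ((sqrt_iter c (Suc n) + sqrt_iter c n) * (sqrt_iter c (Suc n) - sqrt_iter c n))"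
proof -
  define v w where "v = sqrt_iter c n" and "w = sqrt_iter c (Suc n)"
  have "w * v = v * w"
    unfolding v_def w_def by (metis sqrt_iter_commute)
  then have "w * w - v * v = (w + v) * (w - v)" by (simp add: algebra_simps)
  moreover have "sqrt_iter c (Suc (Suc n)) - w = (1/2) *\<^sub>R (w * w - v * v)"
    by (simp add: v_def w_def scaleR_diff_right scaleR_add_right)
  ultimately show ?thesis by (simp add: v_def w_def)
qed

lemma sqrt_iter_one_nonneg: "0 \<le> sqrt_iter (1::real) n"
  by (induction n) auto

lemma sqrt_iter_one_le_one: "sqrt_iter (1::real) n \<le> 1"
proof (induction n)
  case (Suc n)
  have "sqrt_iter 1 n * sqrt_iter 1 n \<le> (1::real)"
    using Suc sqrt_iter_one_nonneg[of n] by (simp add: mult_le_one)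
  then show ?case by simp
qed simp

lemma norm_sqrt_iter_le:
  assumes "norm c \<le> 1"
  shows "norm (sqrt_iter c n) \<le> sqrt_iter 1 n"
proof (induction n)
  case (Suc n)
  have "norm (sqrt_iter c n * sqrt_iter c n) \<le> sqrt_iter 1 n * sqrt_iter 1 n"
    by (meson Suc mult_mono norm_ge_zero norm_mult_ineq order_trans)
  then have "norm (c + sqrt_iter c n * sqrt_iter c n) \<le> 1 + sqrt_iter 1 n * sqrt_iter 1 n"
    using assms norm_triangle_ineq[of c "sqrt_iter c n * sqrt_iter c n"] by linarith
  then show ?case by simp
qed simp

text \<open>The factorization \<open>sqrt_iter_diff\<close> holds for \<open>c\<close> and for 1
  alike, and each factor for \<open>c\<close> is dominated by the one for 1.\<close>

lemma norm_sqrt_iter_diff_le: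
  assumes "norm c \<le> 1"
  shows "norm (sqrt_iter c (Suc n) - sqrt_iter c n) \<le> sqrt_iter 1 (Suc n) - sqrt_iter 1 n"
proof (induction n)
  case 0
  then show ?case using assms by simp
next
  case (Suc n)
  let ?v = "sqrt_iter c n" and ?w = "sqrt_iter c (Suc n)"
  have "norm (?w + ?v) \<le> sqrt_iter 1 (Suc n) + sqrt_iter 1 n"
    using norm_triangle_ineq[of ?w ?v] norm_sqrt_iter_le[OF assms, of n]
      norm_sqrt_iter_le[OF assms, of "Suc n"] by linarith
  then have "norm ((?w + ?v) * (?w - ?v)) \<le>
      (sqrt_iter 1 (Suc n) + sqrt_iter 1 n) * (sqrt_iter 1 (Suc n) - sqrt_iter 1 n)"
    using Suc by (meson mult_mono norm_ge_zero norm_mult_ineq order_trans)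
  then show ?case
    unfolding sqrt_iter_diff by simp
qed

lemma convergent_sqrt_iter:
  fixes c :: "'a::{real_normed_algebra, banach}"
  assumes "norm c \<le> 1"
  shows "convergent (sqrt_iter c)"
proof -
  have "incseq (sqrt_iter (1::real))"
  proof (rule incseq_SucI)
    \<comment> \<open>The domination at \<open>c = 1\<close> says that an increment is at least its
      own absolute value.\<close>
    show "sqrt_iter (1::real) n \<le> sqrt_iter 1 (Suc n)" for n
      using norm_sqrt_iter_diff_le[of "1::real" n]
        norm_ge_zero[of "sqrt_iter (1::real) (Suc n) - sqrt_iter 1 n"] by simp
  qed
  then obtain L where "sqrt_iter (1::real) \<longlonglongrightarrow> L"
    using incseq_convergent[of "sqrt_iter (1::real)" 1] sqrt_iter_one_le_one by blast
  then have "summable (\<lambda>n. sqrt_iter (1::real) (Suc n) - sqrt_iter 1 n)"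
    by (rule telescope_summable)
  then have "summable (\<lambda>n. sqrt_iter c (Suc n) - sqrt_iter c n)"
    by (rule summable_comparison_test[rotated]) (use norm_sqrt_iter_diff_le[OF assms] in blast)
  then have "convergent (\<lambda>n. \<Sum>k<n. sqrt_iter c (Suc k) - sqrt_iter c k)"
    by (simp only: summable_iff_convergent)
  then show ?thesis by (simp only: sum_lessThan_telescope) simp
qed

section \<open>The involution\<close>

lemma scaleC_minus: "scaleC (- c) x = - scaleC c (x::'a::unital_cstar_algebra)"
proof -
  have "scaleC (complex_of_real (-1)) (scaleC c x) = - scaleC c x"
    by (simp only: scaleC_of_real) simp
  then show ?thesis by (simp add: scaleC_scaleC)
qed

lemma scaleC_ii_ii [simp]: "scaleC \<i> (scaleC \<i> x) = - (x::'a::unital_cstar_algebra)"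
  using scaleC_of_real[of "-1" x] by (simp add: scaleC_scaleC)

lemma scaleC_zero [simp]: "scaleC c (0::'a::unital_cstar_algebra) = 0"
  using scaleC_add_right[of c "0::'a" 0] by simp

lemma scaleC_minus_right: "scaleC c (- x) = - scaleC c (x::'a::unital_cstar_algebra)"
  using scaleC_add_right[of c "- x" x] by (simp add: eq_neg_iff_add_eq_0)

lemma scaleC_diff_right: "scaleC c (x - y) = scaleC c x - scaleC c (y::'a::unital_cstar_algebra)"
  using scaleC_add_right[of c x "- y"] by (simp add: scaleC_minus_right)

lemma star_scaleR: "star (r *\<^sub>R x) = r *\<^sub>R star (x::'a::unital_cstar_algebra)"
  by (simp flip: scaleC_of_real add: star_scaleC)

lemma star_zero [simp]: "star (0::'a::unital_cstar_algebra) = 0"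
  using star_add[of "0::'a" 0] by simp

lemma star_minus: "star (- x) = - star (x::'a::unital_cstar_algebra)"
  using star_scaleR[of "-1" x] by simp

lemma star_diff: "star (x - y) = star x - star (y::'a::unital_cstar_algebra)"
  using star_add[of x "- y"] by (simp add: star_minus)

lemma star_one [simp]: "star (1::'a::unital_cstar_algebra) = 1"
  by (metis mult_1_left mult_1_right star_mult star_star)

lemma star_ii: "star (scaleC \<i> x) = - scaleC \<i> (star (x::'a::unital_cstar_algebra))"
  by (simp add: star_scaleC scaleC_minus)

lemma norm_star [simp]: "norm (star x) = norm (x::'a::unital_cstar_algebra)"
proof -
  have le: "norm y \<le> norm (star y)" for y :: 'a
  proof (cases "norm y = 0")
    case False
    have "norm y * norm y \<le> norm (star y) * norm y"
      by (metis cstar_identity norm_mult_ineq power2_eq_square)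
    with False show ?thesis by (simp add: mult_le_cancel_right)
  qed simp
  from le[of x] le[of "star x"] show ?thesis by (simp add: star_star)
qed

text \<open>The norm of 1 is an idempotent real; the value 0 occurs in the zero algebra.\<close>

lemma norm_one_le: "norm (1::'a::unital_cstar_algebra) \<le> 1"
proof -
  have "norm (1::'a) * norm (1::'a) = norm (1::'a)"
    using cstar_identity[of "1::'a"] by (simp add: power2_eq_square)
  then show ?thesis by auto
qed

lemma norm_scaleR_one_le: "0 \<le> t \<Longrightarrow> norm (t *\<^sub>R (1::'a::unital_cstar_algebra)) \<le> t"
  using mult_left_mono[OF norm_one_le, of t] by simp

lemma norm_selfadjoint_square:
  "star a = a \<Longrightarrow> norm (a * a) = (norm (a::'a::unital_cstar_algebra))\<^sup>2"
  by (metis cstar_identity)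

lemma star_mult_self_eq_0: "star x * x = 0 \<Longrightarrow> x = (0::'a::unital_cstar_algebra)"
  using cstar_identity[of x] by simp

lemma tendsto_star: "X \<longlonglongrightarrow> L \<Longrightarrow> (\<lambda>n. star (X n)) \<longlonglongrightarrow> star (L::'a::unital_cstar_algebra)"
  by (simp add: tendsto_iff dist_norm flip: star_diff)

text \<open>The sum is \<open>star w * w\<close> for \<open>w = a + ib\<close>, and \<open>a\<close>
  is the real part of \<open>w\<close>, so its norm is at most that of \<open>w\<close>.\<close>

lemma norm_square_le_sum:
  fixes a b :: "'a::unital_cstar_algebra"
  assumes "star a = a" "star b = b" "a * b = b * a"
  shows "(norm a)\<^sup>2 \<le> norm (a * a + b * b)"
proof -
  define w where "w = a + scaleC \<i> b"
  have sw: "star w = a - scaleC \<i> b"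
    by (simp add: w_def star_add star_ii assms)
  have "star w * w = a * a + b * b"
    unfolding sw
    by (simp add: w_def algebra_simps scaleC_mult_left scaleC_mult_right scaleC_diff_right assms)
  then have "(norm w)\<^sup>2 = norm (a * a + b * b)" by (metis cstar_identity)
  moreover have "a = (1/2) *\<^sub>R (w + star w)"
    unfolding sw by (simp add: w_def flip: scaleR_2)
  then have "norm a = (1/2) * norm (w + star w)"
    by (metis abs_of_nonneg norm_scaleR zero_le_divide_1_iff zero_le_numeral)
  then have "norm a \<le> norm w" using norm_triangle_ineq[of w "star w"] by simp
  ultimately show ?thesis by (metis norm_ge_zero power_mono)
qed

section \<open>Positive elements\<close>

lemma exists_sqrt_one_minus:
  fixes c :: "'a::unital_cstar_algebra"
  assumes "star c = c" "norm c \<le> 1"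
  shows "\<exists>d. star d = d \<and> d * d = 1 - c \<and> norm (1 - d) \<le> 1 \<and> (\<forall>z. c * z = z * c \<longrightarrow> d * z = z * d)"
proof -
  obtain w where w: "sqrt_iter c \<longlonglongrightarrow> w"
    using convergent_sqrt_iter[OF assms(2)] by (auto simp: convergent_def)
  have "(\<lambda>n. sqrt_iter c (Suc n)) \<longlonglongrightarrow> (1/2) *\<^sub>R (c + w * w)"
    unfolding sqrt_iter.simps by (intro tendsto_intros w)
  with w have w_eq: "w = (1/2) *\<^sub>R (c + w * w)"
    using LIMSEQ_Suc LIMSEQ_unique by blast
  have "star (sqrt_iter c n) = sqrt_iter c n" for n
    by (induction n) (simp_all add: star_scaleR star_add star_mult assms)
  with tendsto_star[OF w] w have "star w = w"
    by (simp add: LIMSEQ_unique)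
  then have "star (1 - w) = 1 - w" by (simp add: star_diff)
  moreover have "norm w \<le> 1"
    by (rule Lim_bounded[OF tendsto_norm[OF w], of 0])
       (meson norm_sqrt_iter_le[OF assms(2)] order_trans sqrt_iter_one_le_one)
  then have "norm (1 - (1 - w)) \<le> 1" by simp
  moreover have "(1 - w) * z = z * (1 - w)" if "c * z = z * c" for z
  proof -
    have "w * z = z * w"
      using tendsto_mult_right[OF w, of z] tendsto_mult_left[OF w, of z]
      by (simp add: sqrt_iter_commute[OF that] LIMSEQ_unique)
    then show ?thesis by (simp add: left_diff_distrib right_diff_distrib)
  qed
  moreover have "w + w = c + w * w"
    using w_eq by (metis scaleR_half_double scaleR_add_right)
  then have "(1 - w) * (1 - w) = 1 - c" by (simp add: algebra_simps)
  ultimately show ?thesis by blast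
qed

text \<open>For self-adjoint \<open>h\<close>, this expresses a nonnegative spectrum through the
  norm alone.\<close>

definition spectrally_positive :: "'a::unital_cstar_algebra \<Rightarrow> bool" where
  "spectrally_positive h \<longleftrightarrow> star h = h \<and> norm (norm h *\<^sub>R 1 - h) \<le> norm h"

text \<open>Rescaling by \<open>t\<close> reduces this to \<open>exists_sqrt_one_minus\<close>. The
  norm bound on \<open>d\<close> makes the root itself positive.\<close>

lemma exists_sqrt:
  fixes h :: "'a::unital_cstar_algebra"
  assumes "star h = h" "norm (t *\<^sub>R 1 - h) \<le> t"
  shows "\<exists>d. star d = d \<and> d * d = h \<and> norm (sqrt t *\<^sub>R 1 - d) \<le> sqrt t \<and>
    (\<forall>z. h * z = z * h \<longrightarrow> d * z = z * d)"
proof (cases "t = 0")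
  case True
  with assms have "h = 0" by simp
  with True show ?thesis by (intro exI[of _ 0]) simp
next
  case False
  with assms(2) have t: "t > 0" using norm_ge_zero[of "t *\<^sub>R 1 - h"] by linarith
  define c where "c = 1 - (1/t) *\<^sub>R h"
  have "c = (1/t) *\<^sub>R (t *\<^sub>R 1 - h)" using t by (simp add: c_def scaleR_diff_right)
  then have "norm c = (1/t) * norm (t *\<^sub>R 1 - h)" using t by simp
  then have "norm c \<le> 1" using t assms(2) by simp
  moreover have "star c = c" by (simp add: c_def star_diff star_scaleR assms)
  ultimately obtain d where d: "star d = d" "d * d = 1 - c" "norm (1 - d) \<le> 1"
    "\<And>z. c * z = z * c \<Longrightarrow> d * z = z * d"
    using exists_sqrt_one_minus by blast
  have "(sqrt t *\<^sub>R d) * (sqrt t *\<^sub>R d) = h"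
    using t by (simp add: d(2) c_def)
  moreover have "norm (sqrt t *\<^sub>R (1 - d)) \<le> sqrt t"
    using d(3) t by simp
  then have "norm (sqrt t *\<^sub>R 1 - sqrt t *\<^sub>R d) \<le> sqrt t"
    by (simp add: scaleR_diff_right)
  moreover have "(sqrt t *\<^sub>R d) * z = z * (sqrt t *\<^sub>R d)" if "h * z = z * h" for z
  proof -
    have "d * z = z * d"
      by (rule d(4)) (simp add: c_def left_diff_distrib right_diff_distrib that)
    then show ?thesis by simp
  qed
  moreover have "star (sqrt t *\<^sub>R d) = sqrt t *\<^sub>R d" by (simp add: star_scaleR d(1))
  ultimately show ?thesis by blast
qed

text \<open>The element \<open>h = t - aa\<close> has a self-adjoint root \<open>d\<close> commuting
  with \<open>a\<close>. Since \<open>dd + aa = t\<close>, \<open>norm_square_le_sum\<close> bounds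
  the norm of \<open>dd = h\<close>.\<close>

lemma norm_diff_square_le:
  fixes a :: "'a::unital_cstar_algebra"
  assumes "star a = a" "(norm a)\<^sup>2 \<le> t"
  shows "norm (t *\<^sub>R 1 - a * a) \<le> t"
proof -
  have t: "t \<ge> 0" using assms(2) by (meson order_trans zero_le_power2)
  define h where "h = t *\<^sub>R 1 - a * a"
  have "star h = h" by (simp add: h_def star_diff star_scaleR star_mult assms)
  moreover have "norm (t *\<^sub>R 1 - h) \<le> t"
    by (simp add: h_def norm_selfadjoint_square assms)
  ultimately obtain d where d: "star d = d" "d * d = h" "\<And>z. h * z = z * h \<Longrightarrow> d * z = z * d"
    using exists_sqrt by blast
  have "h * a = a * h" by (simp add: h_def algebra_simps)
  then have "d * a = a * d" by (rule d(3))
  then have "(norm d)\<^sup>2 \<le> norm (h + a * a)"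
    using norm_square_le_sum[of d a] d(1,2) assms(1) by simp
  also have "\<dots> \<le> t" using norm_scaleR_one_le[OF t] by (simp add: h_def)
  finally show ?thesis using d(1) by (simp add: norm_selfadjoint_square flip: h_def d(2))
qed

lemma spectrally_positive_square:
  assumes "star a = a"
  shows "spectrally_positive (a * a)"
  using assms norm_diff_square_le[of a "(norm a)\<^sup>2"]
  by (simp add: spectrally_positive_def star_mult norm_selfadjoint_square)

text \<open>Any bound \<open>t\<close> yields a self-adjoint square root, and squares satisfy the
  inequality with \<open>t = norm h\<close>.\<close>

lemma spectrally_positiveI:
  assumes "star h = h" "norm (t *\<^sub>R 1 - h) \<le> t"
  shows "spectrally_positive h"
  using exists_sqrt[OF assms] spectrally_positive_square by metis

lemma spectrally_positive_sqrt:
  assumes "spectrally_positive h"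
  obtains d where "star d = d" "d * d = h" "spectrally_positive d"
    "\<forall>z. h * z = z * h \<longrightarrow> d * z = z * d"
  using assms exists_sqrt[of h "norm h"] spectrally_positiveI
  unfolding spectrally_positive_def by metis

section \<open>The convex cone of spectrally positive elements\<close>

lemma spectrally_positive_add:
  assumes "spectrally_positive g" "spectrally_positive h"
  shows "spectrally_positive (g + h)"
proof (rule spectrally_positiveI)
  have "norm ((norm g + norm h) *\<^sub>R 1 - (g + h)) =
      norm ((norm g *\<^sub>R 1 - g) + (norm h *\<^sub>R 1 - h))"
    by (simp only: scaleR_add_left add_diff_add)
  also have "\<dots> \<le> norm g + norm h"
    using assms by (intro norm_triangle_mono) (simp_all add: spectrally_positive_def)
  finally show "norm ((norm g + norm h) *\<^sub>R 1 - (g + h)) \<le> norm g + norm h" .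
qed (use assms in \<open>simp add: spectrally_positive_def star_add\<close>)

lemma spectrally_positive_scaleR:
  assumes "spectrally_positive h" "0 \<le> r"
  shows "spectrally_positive (r *\<^sub>R h)"
proof -
  have "norm (r *\<^sub>R (norm h *\<^sub>R 1 - h)) \<le> r * norm h"
    using assms by (simp add: spectrally_positive_def mult_left_mono)
  then show ?thesis
    using assms by (simp add: spectrally_positive_def star_scaleR scaleR_diff_right)
qed

text \<open>Roots \<open>a\<close> of \<open>h\<close> and \<open>b\<close> of \<open>-h\<close> can
  be chosen to commute; as \<open>aa + bb = 0\<close>, \<open>norm_square_le_sum\<close> gives
  \<open>a = 0\<close>.\<close>

lemma spectrally_positive_antisym:
  assumes "spectrally_positive h" "spectrally_positive (- h)"
  shows "h = 0"
proof -
  obtain a where a: "star a = a" "a * a = h" "spectrally_positive a"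
    "\<forall>z. h * z = z * h \<longrightarrow> a * z = z * a"
    using spectrally_positive_sqrt[OF assms(1)] by blast
  obtain b where b: "star b = b" "b * b = - h" "spectrally_positive b"
    "\<forall>z. - h * z = z * - h \<longrightarrow> b * z = z * b"
    using spectrally_positive_sqrt[OF assms(2)] by blast
  have "h * a = a * h" by (simp add: mult.assoc flip: a(2))
  then have "b * a = a * b" by (intro b(4)[rule_format]) simp
  then have "(norm a)\<^sup>2 \<le> norm (a * a + b * b)"
    by (intro norm_square_le_sum) (simp_all add: a(1) b(1))
  then show ?thesis by (simp add: b(2) flip: a(2))
qed

text \<open>With \<open>n = \<parallel>y\<parallel>\<^sup>2\<close>, the identity \<open>(n + rr) y\<^sup>* = y\<^sup>* (n - yy\<^sup>*)\<close> bounds the left side by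
  \<open>n \<parallel>y\<parallel>\<close>, whereas \<open>n + rr\<close> increases the norm of \<open>y\<^sup>*\<close> by a factor greater than \<open>n\<close>
  unless \<open>y = 0\<close>.\<close>

lemma star_mult_self_eq_neg_square:
  fixes y r :: "'a::unital_cstar_algebra"
  assumes y: "star y * y = - (r * r)" and r: "star r = r"
    and pos: "spectrally_positive (y * star y)"
  shows "y = 0"
proof -
  define n q where "n = (norm y)\<^sup>2" and "q = r * r"
  define u where "u = n *\<^sub>R 1 + q"
  have n: "norm (y * star y) = n" "norm q = n" "n \<ge> 0"
    using cstar_identity[of "star y"] cstar_identity[of y]
    by (simp_all add: n_def q_def star_star y)
  have q: "star q = q" "star u = u"
    by (simp_all add: q_def u_def star_mult star_add star_scaleR r)
  have "u * star y = star y * (n *\<^sub>R 1 - y * star y)"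
  proof -
    have "q * star y = - (star y * (y * star y))"
      by (simp add: q_def y flip: mult.assoc)
    then show ?thesis by (simp add: u_def algebra_simps)
  qed
  moreover have "norm (n *\<^sub>R 1 - y * star y) \<le> n"
    using pos by (simp add: spectrally_positive_def n)
  then have "norm (star y * (n *\<^sub>R 1 - y * star y)) \<le> norm y * n"
    by (metis mult_left_mono norm_ge_zero norm_mult_ineq norm_star order_trans)
  ultimately have le: "norm (u * star y) \<le> norm y * n" by simp
  have "(norm (u * star y))\<^sup>2 = norm (u * star y * (y * u))"
    by (metis cstar_identity norm_star q(2) star_mult star_star)
  also have "u * star y * (y * u) = - (u * q * u)"
    by (metis q_def y mult.assoc mult_minus_left mult_minus_right)
  finally have "norm (u * q * u) = (norm (u * star y))\<^sup>2" by simp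
  also have "\<dots> \<le> n * n\<^sup>2"
    using power_mono[OF le, of 2] by (simp add: power_mult_distrib n_def)
  finally have upper: "norm (u * q * u) \<le> n * n\<^sup>2" .
  \<comment> \<open>Expanding, \<open>uqu\<close> equals \<open>2n qq + q(nn + qq)\<close>. Both
    terms are squares of commuting self-adjoint elements \<open>A\<close> and \<open>B = rd\<close>,
    so the norm of \<open>uqu\<close> is at least that of \<open>AA\<close>, namely twice the upper
    bound just found.\<close>
  have "spectrally_positive (n\<^sup>2 *\<^sub>R 1 + q * q)"
    using spectrally_positive_add[OF spectrally_positive_square[of "n *\<^sub>R 1"]
        spectrally_positive_square[of q]] q
    by (simp add: star_scaleR power2_eq_square)
  then obtain d where d: "star d = d" "d * d = n\<^sup>2 *\<^sub>R 1 + q * q" "spectrally_positive d"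
    "\<forall>z. (n\<^sup>2 *\<^sub>R 1 + q * q) * z = z * (n\<^sup>2 *\<^sub>R 1 + q * q) \<longrightarrow> d * z = z * d"
    using spectrally_positive_sqrt by blast
  have dr: "d * r = r * d"
    by (rule d(4)[rule_format]) (simp add: q_def algebra_simps)
  define A B where "A = sqrt (2 * n) *\<^sub>R q" and "B = r * d"
  have "B * B = r * r * (d * d)"
    unfolding B_def by (metis dr mult.assoc)
  moreover have "A * A = (2 * n) *\<^sub>R (q * q)"
    using n(3) by (simp add: A_def)
  ultimately have "A * A + B * B = u * q * u"
    by (simp add: d(2) u_def algebra_simps scaleR_2 power2_eq_square flip: q_def scaleR_scaleR)
  moreover have "(norm A)\<^sup>2 \<le> norm (A * A + B * B)"
  proof (rule norm_square_le_sum)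
    have "d * q = q * d" unfolding q_def by (metis dr mult.assoc)
    then show "A * B = B * A" unfolding A_def B_def q_def by (simp add: mult.assoc)
  qed (simp_all add: A_def B_def star_scaleR star_mult q r d(1) dr)
  moreover have "(norm A)\<^sup>2 = 2 * (n * n\<^sup>2)"
    using n by (simp add: A_def power_mult_distrib)
  ultimately have "n * n\<^sup>2 \<le> 0" using upper by simp
  then have "n = 0" using n(3) by (simp add: power2_eq_square mult_le_0_iff)
  then show ?thesis by (simp add: n_def)
qed

text \<open>Here \<open>m = \<bar>h\<bar>\<close> and \<open>k\<close> is the negative part of \<open>h = x\<^sup>*x\<close>; then \<open>y = xk\<close> has
  \<open>y\<^sup>*y = - k\<^sup>3\<close>, which forces \<open>y = 0\<close>.\<close>

lemma spectrally_positive_star_mult_self: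
  fixes x :: "'a::unital_cstar_algebra"
  shows "spectrally_positive (star x * x)"
proof -
  define h where "h = star x * x"
  have h: "star h = h" by (simp add: h_def star_mult star_star)
  obtain m where m: "star m = m" "m * m = h * h" "spectrally_positive m"
      "\<forall>z. h * h * z = z * (h * h) \<longrightarrow> m * z = z * m"
    using spectrally_positive_sqrt[OF spectrally_positive_square[OF h]] by blast
  have mh: "m * h = h * m" by (rule m(4)[rule_format]) (simp add: mult.assoc)
  obtain s where s: "star s = s" "s * s = m" "spectrally_positive s"
    "\<forall>z. m * z = z * m \<longrightarrow> s * z = z * s"
    using spectrally_positive_sqrt[OF m(3)] by blast
  define k where "k = (1/2) *\<^sub>R (m - h)"
  have k: "star k = k" by (simp add: k_def star_scaleR star_diff m h)
  have sk: "s * k = k * s"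
    by (rule s(4)[rule_format]) (simp add: k_def algebra_simps mh)
  \<comment> \<open>From \<open>mm = hh\<close> one gets
    \<open>(m - h)h = mh - mm = -m(m - h)\<close>.\<close>
  have kh: "k * h = - (m * k)"
    by (simp add: k_def algebra_simps m(2) mh)
  \<comment> \<open>The root \<open>s\<close> of \<open>m\<close> commutes with \<open>k\<close>, so
    \<open>mkk\<close> becomes the square of the self-adjoint \<open>r\<close>.\<close>
  define y r where "y = x * k" and "r = k * s"
  have r: "star r = r" by (simp add: r_def star_mult k s sk)
  have "star y * y = k * h * k" by (simp add: y_def star_mult k h_def mult.assoc)
  also have "\<dots> = - (m * k * k)" by (simp add: kh)
  also have "m * k * k = r * r"
    unfolding r_def by (metis s(2) sk mult.assoc)
  finally have yr: "star y * y = - (r * r)" .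
  \<comment> \<open>These are the real and imaginary parts of \<open>y\<close>. They express
    \<open>y * star y\<close> as a sum of squares, which puts it in the cone.\<close>
  define p q where "p = (1/2) *\<^sub>R (y + star y)" and "q = (1/2) *\<^sub>R scaleC \<i> (star y - y)"
  have pq: "star p = p" "star q = q"
    by (simp_all add: p_def q_def star_scaleR star_add star_diff star_ii star_star scaleC_diff_right
        add.commute)
  have "y * star y + star y * y = 2 *\<^sub>R (p * p + q * q)"
  proof -
    have "4 *\<^sub>R (p * p) = (y + star y) * (y + star y)" by (simp add: p_def)
    moreover have "4 *\<^sub>R (q * q) = - ((star y - y) * (star y - y))"
    proof -
      have "4 *\<^sub>R (q * q) = scaleC \<i> (star y - y) * scaleC \<i> (star y - y)" by (simp add: q_def)
      then show ?thesis by (simp only: scaleC_mult_left scaleC_mult_right scaleC_ii_ii)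
    qed
    ultimately have "4 *\<^sub>R (p * p + q * q) = 2 *\<^sub>R (y * star y + star y * y)"
      by (simp add: scaleR_add_right scaleR_2 algebra_simps)
    then have "(1/2) *\<^sub>R (4 *\<^sub>R (p * p + q * q)) = y * star y + star y * y" by simp
    then show ?thesis by simp
  qed
  then have "y * star y = 2 *\<^sub>R (p * p + q * q) + r * r"
    by (simp add: yr algebra_simps)
  then have "spectrally_positive (y * star y)"
    by (simp add: spectrally_positive_add spectrally_positive_scaleR spectrally_positive_square pq r
        del: scaleR_add_right)
  then have "y = 0" using star_mult_self_eq_neg_square yr r by blast
  then have "k * h * k = 0" by (simp add: y_def h_def k star_mult mult.assoc)
  then have r0: "r = 0"
    using yr \<open>y = 0\<close> r star_mult_self_eq_0[of r] by simp
  \<comment> \<open>Now \<open>mkk = 0\<close> and \<open>hkk = -mkk\<close>, so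
    \<open>kkk = 0\<close>. Applying the C*-identity to \<open>kk\<close> and then to
    \<open>k\<close> gives \<open>k = 0\<close>.\<close>
  have "h * k = k * h" by (simp add: k_def algebra_simps mh)
  then have "h * k * k = - (m * k * k)" by (simp add: kh)
  moreover have "m * k * k = 0" using r0 \<open>m * k * k = r * r\<close> by simp
  ultimately have "(m - h) * k * k = 0" by (simp add: left_diff_distrib)
  then have "k * k * k = 0" by (simp add: k_def)
  then have "star (k * k) * (k * k) = 0" by (simp add: star_mult k mult.assoc)
  then have "star k * k = 0" using star_mult_self_eq_0 k by metis
  then have "k = 0" by (rule star_mult_self_eq_0)
  then have "h = m" by (simp add: k_def)
  with m(3) show ?thesis by (simp add: h_def)
qed

lemma cstar_positive_imp_spectrally_positive:
  "cstar_positive h \<Longrightarrow> spectrally_positive h"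
  unfolding cstar_positive_def using spectrally_positive_star_mult_self by blast

lemma spectrally_positive_imp_cstar_positive:
  "spectrally_positive h \<Longrightarrow> cstar_positive h"
  unfolding cstar_positive_def by (metis spectrally_positive_sqrt)

section \<open>Absence of lines in the positive cone\<close>

text \<open>Dividing by large positive and negative \<open>t\<close> makes \<open>a\<close>
  negligible, so \<open>h\<close> and \<open>-h\<close> are both positive.\<close>

lemma spectrally_positive_perturbation:
  fixes a h :: "'a::unital_cstar_algebra"
  assumes "\<And>t::real. spectrally_positive (a + t *\<^sub>R h)"
  shows "h = 0"
proof -
  define M where "M = norm h"
  have a: "star a = a" using assms[of 0] by (simp add: spectrally_positive_def)
  have "star (a + 1 *\<^sub>R h) = a + 1 *\<^sub>R h"
    using assms[of 1] unfolding spectrally_positive_def by blast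
  then have h: "star h = h" by (simp add: a star_add)
  have bound: "norm (M *\<^sub>R 1 - e *\<^sub>R h) \<le> M" if e: "e = 1 \<or> e = -1" for e :: real
  proof (rule field_le_epsilon)
    fix \<epsilon> :: real
    assume \<epsilon>: "\<epsilon> > 0"
    \<comment> \<open>The error is at most \<open>3 * norm a\<close>: one \<open>norm a\<close> from
      \<open>s\<close>, two from \<open>a - norm a\<close>. The added 1 keeps \<open>t\<close>
      positive.\<close>
    define t where "t = (3 * norm a + 1) / \<epsilon>"
    have t: "t > 0" using \<epsilon> by (simp add: t_def add_nonneg_pos)
    define g s where "g = a + (t * e) *\<^sub>R h" and "s = norm a + t * M"
    have "norm g \<le> norm a + norm ((t * e) *\<^sub>R h)" unfolding g_def by (rule norm_triangle_ineq)
    also have "\<dots> = s" using e t by (auto simp: s_def M_def)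
    finally have gs: "norm g \<le> s" .
    have g: "spectrally_positive g" unfolding g_def by (rule assms)
    have "s *\<^sub>R 1 - g = (s - norm g) *\<^sub>R 1 + (norm g *\<^sub>R 1 - g)"
      by (simp add: scaleR_diff_left)
    then have "norm (s *\<^sub>R 1 - g) \<le> norm ((s - norm g) *\<^sub>R (1::'a)) + norm (norm g *\<^sub>R 1 - g)"
      by (metis norm_triangle_ineq)
    also have "\<dots> \<le> (s - norm g) + norm g"
      using g gs norm_scaleR_one_le[of "s - norm g", where 'a='a]
      unfolding spectrally_positive_def by linarith
    finally have sg: "norm (s *\<^sub>R 1 - g) \<le> s" by simp
    have "t *\<^sub>R (M *\<^sub>R 1 - e *\<^sub>R h) = (s *\<^sub>R 1 - g) + (a - norm a *\<^sub>R 1)"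
      by (simp add: s_def g_def scaleR_diff_right scaleR_add_left)
    then have "norm (t *\<^sub>R (M *\<^sub>R 1 - e *\<^sub>R h)) \<le> norm (s *\<^sub>R 1 - g) + norm (a - norm a *\<^sub>R 1)"
      by (metis norm_triangle_ineq)
    also have "norm (a - norm a *\<^sub>R 1) \<le> norm a + norm (norm a *\<^sub>R (1::'a))"
      by (rule norm_triangle_ineq4)
    also have "\<dots> \<le> norm a + norm a"
      using norm_scaleR_one_le[of "norm a", where 'a='a] by simp
    finally have "t * norm (M *\<^sub>R 1 - e *\<^sub>R h) \<le> t * M + 3 * norm a"
      using t sg by (simp add: s_def)
    also have "3 * norm a \<le> t * \<epsilon>"
      using \<epsilon> by (simp add: t_def)
    finally have "t * norm (M *\<^sub>R 1 - e *\<^sub>R h) \<le> t * (M + \<epsilon>)"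
      by (simp add: distrib_left)
    then show "norm (M *\<^sub>R 1 - e *\<^sub>R h) \<le> M + \<epsilon>"
      using t by simp
  qed
  have "spectrally_positive h" "spectrally_positive (- h)"
    using bound[of 1] bound[of "-1"]
    by (auto simp: spectrally_positive_def star_minus h M_def)
  then show ?thesis by (rule spectrally_positive_antisym)
qed

section \<open>Schwarz-positive maps\<close>

lemma clinear_add: "clinear F \<Longrightarrow> F (x + y) = F x + F y"
  by (simp add: Vector_Spaces.linear_iff)

lemma clinear_scaleC: "clinear F \<Longrightarrow> F (scaleC c x) = scaleC c (F x)"
  by (simp add: Vector_Spaces.linear_iff)

lemma clinear_scaleR: "clinear F \<Longrightarrow> F (r *\<^sub>R x) = r *\<^sub>R F x"
  by (simp add: clinear_scaleC flip: scaleC_of_real)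

lemma clinear_diff: "clinear F \<Longrightarrow> F (x - y) = F x - F y"
  using clinear_add[of F "x - y" y] by simp

lemma clinear_minus: "clinear F \<Longrightarrow> F (- x) = - F x"
  using clinear_scaleR[of F "-1" x] by simp

text \<open>Polarization: \<open>b + star b\<close> and \<open>i(star b - b)\<close> are
  combinations of elements \<open>star x * x\<close> with \<open>x\<close> among
  \<open>b + 1\<close>, \<open>b + i\<close>, \<open>b\<close> and 1. Their images are therefore
  self-adjoint.\<close>

lemma selfadjoint_images_imp_star:
  fixes F :: "'b::unital_cstar_algebra \<Rightarrow> 'a::unital_cstar_algebra"
  assumes F: "clinear F" and sa: "\<And>x. star (F (star x * x)) = F (star x * x)"
  shows "F (star b) = star (F b)"
proof -
  have sa': "star (F (star x * x - (star y * y + star z * z))) =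
      F (star x * x - (star y * y + star z * z))" for x y z
    by (simp only: clinear_add[OF F] clinear_diff[OF F] star_add star_diff sa)
  have "star (b + 1) * (b + 1) - (star b * b + star 1 * 1) = b + star b"
    by (simp add: star_add algebra_simps)
  then have sum: "star (F (b + star b)) = F (b + star b)"
    using sa'[of "b + 1" b 1] by simp
  have "star (b + scaleC \<i> 1) * (b + scaleC \<i> 1) - (star b * b + star 1 * 1) =
      scaleC \<i> (star b - b)"
    by (simp add: star_add star_ii scaleC_mult_left scaleC_mult_right algebra_simps scaleC_diff_right)
  then have "star (F (scaleC \<i> (star b - b))) = F (scaleC \<i> (star b - b))"
    using sa'[of "b + scaleC \<i> 1" b 1] by simp
  then have "- scaleC \<i> (star (F (star b - b))) = scaleC \<i> (F (star b - b))"
    by (simp add: clinear_scaleC[OF F] star_ii)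
  then have "scaleC \<i> (- scaleC \<i> (star (F (star b - b)))) = scaleC \<i> (scaleC \<i> (F (star b - b)))"
    by simp
  then have "star (F (star b - b)) = - F (star b - b)"
    by (simp add: scaleC_minus_right)
  then have diff: "star (F (star b)) - star (F b) = F b - F (star b)"
    by (simp add: clinear_diff[OF F] star_diff)
  from sum have sum': "star (F b) + star (F (star b)) = F b + F (star b)"
    by (simp add: clinear_add[OF F] star_add)
  have "star (F b) + star (F b) =
      (star (F b) + star (F (star b))) - (star (F (star b)) - star (F b))" by simp
  also have "\<dots> = F (star b) + F (star b)" unfolding sum' diff by simp
  finally have "2 *\<^sub>R star (F b) = 2 *\<^sub>R F (star b)" by (simp add: scaleR_2)
  then show ?thesis by simp
qed

lemma SPU_schwarz:
  "SPU F \<Longrightarrow> spectrally_positive (F (star x * x) - star (F x) * F x)"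
  unfolding SPU_def cstar_le_def using cstar_positive_imp_spectrally_positive by blast

lemma SPU_positive:
  assumes "SPU F"
  shows "spectrally_positive (F (star x * x))"
  using spectrally_positive_add[OF SPU_schwarz[OF assms]
      spectrally_positive_star_mult_self[of "F x"], of x] by simp

lemma SPU_star: "SPU F \<Longrightarrow> F (star b) = star (F b)"
  using SPU_positive unfolding spectrally_positive_def SPU_def
  by (intro selfadjoint_images_imp_star) blast+

text \<open>The defect \<open>D\<close> is sesquilinear. As \<open>D b b = 0\<close>, the positive
  element \<open>D (x + tb) (x + tb)\<close> is affine in \<open>t\<close>, so its slope
  vanishes.\<close>

lemma SPU_multiplicative_domain:
  fixes F :: "'b::unital_cstar_algebra \<Rightarrow> 'a::unital_cstar_algebra"
  assumes SPU: "SPU F" and b: "F (star b * b) = star (F b) * F b"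
  shows "F (star b * x) = star (F b) * F x"
proof -
  have F: "clinear F" using SPU by (simp add: SPU_def)
  define D where "D x y = F (star x * y) - star (F x) * F y" for x y
  have D0: "D b b = 0" by (simp add: D_def b)
  have sym: "D x b + D b x = 0" for x
  proof (rule spectrally_positive_perturbation)
    fix t :: real
    have "D (x + t *\<^sub>R b) (x + t *\<^sub>R b) = D x x + t *\<^sub>R (D x b + D b x) + (t * t) *\<^sub>R D b b"
      by (simp add: D_def clinear_add[OF F] clinear_scaleR[OF F] star_add star_scaleR algebra_simps)
    then have "D (x + t *\<^sub>R b) (x + t *\<^sub>R b) = D x x + t *\<^sub>R (D x b + D b x)"
      by (simp add: D0)
    then show "spectrally_positive (D x x + t *\<^sub>R (D x b + D b x))"
      using SPU_schwarz[OF SPU, of "x + t *\<^sub>R b"] by (simp add: D_def)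
  qed
  \<comment> \<open>Replacing \<open>x\<close> by \<open>ix\<close> changes the relative sign of the
    two terms, so both their sum and their difference vanish.\<close>
  have "D (scaleC \<i> x) b = - scaleC \<i> (D x b)" "D b (scaleC \<i> x) = scaleC \<i> (D b x)"
    by (simp_all add: D_def star_ii clinear_scaleC[OF F] scaleC_mult_left scaleC_mult_right
        scaleC_diff_right clinear_minus[OF F])
  then have "scaleC \<i> (D b x - D x b) = 0"
    using sym[of "scaleC \<i> x"] by (simp add: scaleC_diff_right)
  then have "scaleC \<i> (scaleC \<i> (D b x - D x b)) = 0" by simp
  then have "D b x = D x b" by simp
  with sym[of x] have "2 *\<^sub>R D b x = 0" by (simp add: scaleR_2)
  then show ?thesis by (simp add: D_def)
qed

lemma SPU_comp_homomorphism_multiplicative: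
  fixes G :: "'c::unital_cstar_algebra \<Rightarrow> 'b::unital_cstar_algebra"
    and F :: "'b \<Rightarrow> 'a::unital_cstar_algebra"
  assumes hom: "star_homomorphism (F \<circ> G)" and G: "SPU G" and F: "SPU F"
  shows "F (G c * b) = F (G c) * F b"
proof -
  have FG: "F (G (x * y)) = F (G x) * F (G y)" for x y
    using hom by (simp add: star_homomorphism_def)
  have linF: "clinear F" using F by (simp add: SPU_def)
  \<comment> \<open>The multiplicative domain lemma has a starred left factor; here
    \<open>star (G d) = G c\<close>.\<close>
  define d where "d = star c"
  define p where "p = F (star (G d) * G d) - star (F (G d)) * F (G d)"
  have "F (G (star d * d)) = star (F (G d)) * F (G d)"
    by (simp add: FG SPU_star[OF F] SPU_star[OF G])
  \<comment> \<open>Since \<open>F\<close> after \<open>G\<close> is multiplicative,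
    \<open>-p\<close> is the image under \<open>F\<close> of the Schwarz defect of \<open>G\<close>,
    while \<open>p\<close> is the Schwarz defect of \<open>F\<close>.\<close>
  then have "- p = F (G (star d * d) - star (G d) * G d)"
    by (simp add: p_def clinear_diff[OF linF])
  moreover obtain z where "G (star d * d) - star (G d) * G d = star z * z"
    using G unfolding SPU_def cstar_le_def cstar_positive_def by metis
  ultimately have "spectrally_positive (- p)" using SPU_positive[OF F] by simp
  moreover have "spectrally_positive p" unfolding p_def by (rule SPU_schwarz[OF F])
  ultimately have "p = 0" by (simp add: spectrally_positive_antisym)
  then have "F (star (G d) * G d) = star (F (G d)) * F (G d)" by (simp add: p_def)
  then have "F (star (G d) * b) = star (F (G d)) * F b"
    by (rule SPU_multiplicative_domain[OF F])
  then show ?thesis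
    by (simp add: d_def star_star SPU_star[OF F] SPU_star[OF G])
qed

section \<open>From complete positivity to the Schwarz inequality\<close>

lemma CPU_imp_SPU:
  fixes F :: "'b::unital_cstar_algebra \<Rightarrow> 'a::unital_cstar_algebra"
  assumes "CPU F"
  shows "SPU F"
proof -
  have lin: "clinear F" and one: "F 1 = 1"
    and pos: "\<And>n M. mat_positive n M \<Longrightarrow> mat_positive n (map_mat F M)"
    using assms unfolding CPU_def by blast+
  have "cstar_positive (F (star b * b) - star (F b) * F b)" for b
  proof -
    define X where "X = mat 2 2 (\<lambda>(i, j). if i = 0 then (if j = 0 then 1 else b) else 0)"
    have X: "X \<in> carrier_mat 2 2" by (simp add: X_def)
    have entry: "(mat_star Z * Z) $$ (i, j) =
        star (Z $$ (0, i)) * Z $$ (0, j) + star (Z $$ (1, i)) * Z $$ (1, j)"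
      if "Z \<in> carrier_mat 2 2" "i < 2" "j < 2" for Z :: "'z::unital_cstar_algebra mat" and i j
      using that by (simp add: mat_star_def scalar_prod_def numeral_2_eq_2)
    have "mat_positive 2 (mat_star X * X)" using X by (auto simp: mat_positive_def)
    then obtain Y where Y: "Y \<in> carrier_mat 2 2" "map_mat F (mat_star X * X) = mat_star Y * Y"
      using pos unfolding mat_positive_def by blast
    have eq: "F (star (X $$ (0, i)) * X $$ (0, j) + star (X $$ (1, i)) * X $$ (1, j)) =
        star (Y $$ (0, i)) * Y $$ (0, j) + star (Y $$ (1, i)) * Y $$ (1, j)"
      if "i < 2" "j < 2" for i j
    proof -
      have "map_mat F (mat_star X * X) $$ (i, j) = F ((mat_star X * X) $$ (i, j))"
        using X that by (simp add: mat_star_def)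
      then show ?thesis using entry[OF X that] entry[OF Y(1) that] Y(2) by simp
    qed
    define p q r s where "p = Y $$ (0, 0)" and "q = Y $$ (0, 1)"
      and "r = Y $$ (1, 0)" and "s = Y $$ (1, 1)"
    have X_simps: "X $$ (0, 0) = 1" "X $$ (0, 1) = b" "X $$ (1, 0) = 0" "X $$ (1, 1) = 0"
      by (simp_all add: X_def)
    have pr: "star p * p + star r * r = 1"
      using eq[of 0 0] unfolding X_simps p_def r_def by (simp add: one)
    have Fb: "F b = star p * q + star r * s"
      using eq[of 0 1] unfolding X_simps p_def q_def r_def s_def by simp
    have Fbb: "F (star b * b) = star q * q + star s * s"
      using eq[of 1 1] unfolding X_simps q_def s_def by simp
    \<comment> \<open>The first column of \<open>Y\<close> is isometric, being the pair
      \<open>p\<close>, \<open>r\<close> with \<open>pr\<close>. Subtracting from the second column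
      its component along the first leaves \<open>u\<close>, \<open>v\<close>, whose squared length
      is the Schwarz defect.\<close>
    define w u v where "w = F b" and "u = q - p * w" and "v = s - r * w"
    have wp: "star w = star q * p + star s * r"
      by (simp add: w_def Fb star_add star_mult star_star)
    have "star u * u + star v * v =
      star q * q + star s * s - star w * (star p * q + star r * s)
        - (star q * p + star s * r) * w + star w * (star p * p + star r * r) * w"
      by (simp add: u_def v_def star_diff star_mult algebra_simps)
    also have "\<dots> = F (star b * b) - star (F b) * F b"
      by (simp add: pr Fbb flip: wp Fb w_def)
    finally have "F (star b * b) - star (F b) * F b = star u * u + star v * v" by simp
    then show ?thesis
      by (simp add: spectrally_positive_imp_cstar_positive spectrally_positive_add
          spectrally_positive_star_mult_self)
  qed
  then show ?thesis by (simp add: SPU_def cstar_le_def lin one)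
qed

theorem theorem4p2:
  fixes G :: "'c::unital_cstar_algebra \<Rightarrow> 'b::unital_cstar_algebra"
    and F :: "'b \<Rightarrow> 'a::unital_cstar_algebra"
  assumes "star_homomorphism (F \<circ> G)"
  shows "(SPU G \<and> SPU F \<longrightarrow> (\<forall>C B. F (G C * B) = F (G C) * F B)) \<and>
    (fin_dim_algebra TYPE('c) \<and> fin_dim_algebra TYPE('b) \<and> fin_dim_algebra TYPE('a) \<and>
      CPU G \<and> CPU F \<longrightarrow> (\<forall>C B. F (G C * B) = F (G C) * F B))"
  by (intro conjI impI allI; elim conjE)
    (simp_all add: SPU_comp_homomorphism_multiplicative[OF assms] CPU_imp_SPU)

end
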